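(* $\mathrm{NWTL}^++\mathcal{W}$ is exponentially more succinct than $\mathrm{NWTL}^+$: there is a sequence $(\phi_n)_{n\ge1}$ of $\mathrm{NWTL}^++\mathcal{W}$ formulas with $|\phi_n|=O(n)$ such that the smallest $\mathrm{NWTL}^+$ formula equivalent to $\phi_n$ (over nested $\omega$-words over the alphabet $2^{AP}$) has size $2^{\Omega(n)}$.
   Context: Let $AP$ be a finite set of atomic propositions (allowed to grow with $n$) and $\Sigma=2^{AP}$. A matching on $\mathbb{N}$ is a binary relation $\mu$ with unary relations $\mathit{call},\mathit{ret}$ such that: (1) $\mu(i,j)$ implies $\mathit{call}(i)$, $\mathit{ret}(j)$, $i<j$; (2) if $\mu(i,j),\mu(i,j')$ then $j=j'$, and if $\mu(i,j),\mu(i',j)$ then $i=i'$; (3) if $i\le j$, $\mathit{call}(i)$, $\mathit{ret}(j)$ then some $k\in[i,j]$ has $\mu(i,k)$ or $\mu(k,j)$. A nested $\omega$-word is an infinite word $a_1a_2\cdots$ over $\Sigma$ with a matching on $\mathbb{N}$; if $\mu(i,j)$, $i$ is a matched call and $r(i)=j$. $\mathcal{C}(i)$ is the greatest matched call $j<i$ with $r(j)>i$. $\bar w[i,j]$ is the nested subword induced by positions $i..j$ ($j=\infty$: positions $\ge i$). $\mathrm{NWTL}^+$ formulas are built from $\top$, $p\in AP$ (true at $i$ iff $p\in a_i$), $\mathit{call}$, $\mathit{ret}$ using $\neg$, $\vee$, $\bigcirc$ (truth at $i+1$), $\bigcirc_\mu$ (truth at $r(i)$), $\ominus$ (truth at $i-1$,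 $i>1$), $\ominus_\mu$ (truth at the matching call), and until/since for linear paths ($i_{p+1}=i_p+1$), call paths ($i_p=\mathcal{C}(i_{p+1})$), abstract paths ($i_{p+1}=r(i_p)$ if $i_p$ is a matched call, $i_p+1$ if $i_p$ is not a call and $i_p+1$ is not a matched return), and summary paths from $i$ to $j$ ($i_{p+1}=r(i_p)$ if $i_p$ is a matched call with $r(i_p)\le j$, else $i_p+1$); until: for some $j\ge i$ and such a path from $i$ to $j$, $\psi$ at $j$ and $\phi$ at all earlier path positions; since: mirror image. $\mathrm{NWTL}^++\mathcal{W}$ adds: $(\bar w,i)\models\mathcal{W}\phi$ iff $i$ is a call and $(\bar w[i,j],i)\models\phi$ with $j=r(i)$ if $i$ is matched and $j=\infty$ otherwise. Two formulas are equivalent if they have the same models, i.e. the same nested $\omega$-words $\bar w$ with $(\bar w,1)\models$ formula. *)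

theory Defs
  imports Complex_Main "HOL-Library.Landau_Symbols"
begin

record 'p nword =
  pos :: "nat set"
  lab :: "nat \<Rightarrow> 'p set"
  call :: "nat \<Rightarrow> bool"
  ret :: "nat \<Rightarrow> bool"
  mu :: "nat \<Rightarrow> nat \<Rightarrow> bool"

definition matching ::
  "nat set \<Rightarrow> (nat \<Rightarrow> nat \<Rightarrow> bool) \<Rightarrow> (nat \<Rightarrow> bool) \<Rightarrow> (nat \<Rightarrow> bool) \<Rightarrow> bool" where
  "matching P m c r \<longleftrightarrow>
     (\<forall>i. c i \<longrightarrow> i \<in> P) \<and> (\<forall>i. r i \<longrightarrow> i \<in> P) \<and>
     (\<forall>i j. m i j \<longrightarrow> c i \<and> r j \<and> i < j) \<and>
     (\<forall>i j j'. m i j \<and> m i j' \<longrightarrow> j = j') \<and>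
     (\<forall>i i' j. m i j \<and> m i' j \<longrightarrow> i = i') \<and>
     (\<forall>i j. i \<le> j \<and> c i \<and> r j \<longrightarrow> (\<exists>k\<in>{i..j}. m i k \<or> m k j))"

text \<open>Positions of an \<open>\<omega>\<close>-word are numbered from 1; \<open>A\<close> is the set of atomic propositions,
  so letters are subsets of \<open>A\<close>.\<close>

definition nested_omega_word :: "'p set \<Rightarrow> 'p nword \<Rightarrow> bool" where
  "nested_omega_word A w \<longleftrightarrow>
     pos w = {1..} \<and> (\<forall>i\<in>pos w. lab w i \<subseteq> A) \<and> matching (pos w) (mu w) (call w) (ret w)"

definition matched_call :: "'p nword \<Rightarrow> nat \<Rightarrow> bool" where
  "matched_call w i \<longleftrightarrow> (\<exists>j. mu w i j)"

definition matched_ret :: "'p nword \<Rightarrow> nat \<Rightarrow> bool" where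
  "matched_ret w j \<longleftrightarrow> (\<exists>i. mu w i j)"

definition ret_of :: "'p nword \<Rightarrow> nat \<Rightarrow> nat" where
  "ret_of w i = (THE j. mu w i j)"

text \<open>\<open>innermost_call w i j\<close> states that \<open>\<C>(i)\<close> is defined and equal to \<open>j\<close>.\<close>

definition innermost_call :: "'p nword \<Rightarrow> nat \<Rightarrow> nat \<Rightarrow> bool" where
  "innermost_call w i j \<longleftrightarrow>
     matched_call w j \<and> j < i \<and> ret_of w j > i \<and>
     (\<forall>k. matched_call w k \<and> k < i \<and> ret_of w k > i \<longrightarrow> k \<le> j)"

text \<open>Subwords keep the position numbers of the original word.\<close>

definition subword :: "'p nword \<Rightarrow> nat set \<Rightarrow> 'p nword" where
  "subword w D =
     \<lparr>pos = pos w \<inter> D,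
      lab = lab w,
      call = (\<lambda>i. i \<in> D \<and> call w i),
      ret = (\<lambda>i. i \<in> D \<and> ret w i),
      mu = (\<lambda>i j. i \<in> D \<and> j \<in> D \<and> mu w i j)\<rparr>"

datatype path_kind = Linear | CallPath | Abstract | Summary

text \<open>One step from \<open>x\<close> to \<open>y\<close> on a path whose final position is \<open>j\<close>; only summary paths
  depend on \<open>j\<close>.\<close>

fun path_step :: "'p nword \<Rightarrow> path_kind \<Rightarrow> nat \<Rightarrow> nat \<Rightarrow> nat \<Rightarrow> bool" where
  "path_step w Linear j x y \<longleftrightarrow> y = x + 1"
| "path_step w CallPath j x y \<longleftrightarrow> innermost_call w y x"
| "path_step w Abstract j x y \<longleftrightarrow>
     (matched_call w x \<and> y = ret_of w x) \<or>
     (\<not> call w x \<and> \<not> matched_ret w (x + 1) \<and> y = x + 1)"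
| "path_step w Summary j x y \<longleftrightarrow>
     (if matched_call w x \<and> ret_of w x \<le> j then y = ret_of w x else y = x + 1)"

definition is_path :: "'p nword \<Rightarrow> path_kind \<Rightarrow> nat \<Rightarrow> nat \<Rightarrow> nat list \<Rightarrow> bool" where
  "is_path w K i j xs \<longleftrightarrow>
     xs \<noteq> [] \<and> set xs \<subseteq> pos w \<and> hd xs = i \<and> last xs = j \<and>
     (\<forall>p. p + 1 < length xs \<longrightarrow> path_step w K j (xs ! p) (xs ! (p + 1)))"

datatype (props: 'p) fm =
    Truth
  | Atom 'p
  | IsCall
  | IsRet
  | Neg "'p fm"
  | Or "'p fm" "'p fm"
  | Next "'p fm"
  | NextMu "'p fm"
  | Prev "'p fm"
  | PrevMu "'p fm"
  | Until path_kind "'p fm" "'p fm"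
  | Since path_kind "'p fm" "'p fm"
  | Within "'p fm"

primrec sat :: "'p nword \<Rightarrow> nat \<Rightarrow> 'p fm \<Rightarrow> bool" where
  "sat w i Truth \<longleftrightarrow> True"
| "sat w i (Atom p) \<longleftrightarrow> p \<in> lab w i"
| "sat w i IsCall \<longleftrightarrow> call w i"
| "sat w i IsRet \<longleftrightarrow> ret w i"
| "sat w i (Neg f) \<longleftrightarrow> \<not> sat w i f"
| "sat w i (Or f g) \<longleftrightarrow> sat w i f \<or> sat w i g"
| "sat w i (Next f) \<longleftrightarrow> i + 1 \<in> pos w \<and> sat w (i + 1) f"
| "sat w i (NextMu f) \<longleftrightarrow> matched_call w i \<and> sat w (ret_of w i) f"
| "sat w i (Prev f) \<longleftrightarrow> i > 0 \<and> i - 1 \<in> pos w \<and> sat w (i - 1) f"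
| "sat w i (PrevMu f) \<longleftrightarrow> (\<exists>j. mu w j i \<and> sat w j f)"
| "sat w i (Until K f g) \<longleftrightarrow>
     (\<exists>j\<ge>i. \<exists>xs. is_path w K i j xs \<and> sat w j g \<and>
        (\<forall>p. p + 1 < length xs \<longrightarrow> sat w (xs ! p) f))"
| "sat w i (Since K f g) \<longleftrightarrow>
     (\<exists>j\<le>i. \<exists>xs. is_path w K j i xs \<and> sat w j g \<and>
        (\<forall>p. 0 < p \<and> p < length xs \<longrightarrow> sat w (xs ! p) f))"
| "sat w i (Within f) \<longleftrightarrow>
     call w i \<and>
     sat (subword w (if matched_call w i then {i..ret_of w i} else {i..})) i f"

primrec nwtl_plus :: "'p fm \<Rightarrow> bool" where
  "nwtl_plus Truth \<longleftrightarrow> True"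
| "nwtl_plus (Atom p) \<longleftrightarrow> True"
| "nwtl_plus IsCall \<longleftrightarrow> True"
| "nwtl_plus IsRet \<longleftrightarrow> True"
| "nwtl_plus (Neg f) \<longleftrightarrow> nwtl_plus f"
| "nwtl_plus (Or f g) \<longleftrightarrow> nwtl_plus f \<and> nwtl_plus g"
| "nwtl_plus (Next f) \<longleftrightarrow> nwtl_plus f"
| "nwtl_plus (NextMu f) \<longleftrightarrow> nwtl_plus f"
| "nwtl_plus (Prev f) \<longleftrightarrow> nwtl_plus f"
| "nwtl_plus (PrevMu f) \<longleftrightarrow> nwtl_plus f"
| "nwtl_plus (Until K f g) \<longleftrightarrow> nwtl_plus f \<and> nwtl_plus g"
| "nwtl_plus (Since K f g) \<longleftrightarrow> nwtl_plus f \<and> nwtl_plus g"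
| "nwtl_plus (Within f) \<longleftrightarrow> False"

primrec fsize :: "'p fm \<Rightarrow> nat" where
  "fsize Truth = 1"
| "fsize (Atom p) = 1"
| "fsize IsCall = 1"
| "fsize IsRet = 1"
| "fsize (Neg f) = 1 + fsize f"
| "fsize (Or f g) = 1 + fsize f + fsize g"
| "fsize (Next f) = 1 + fsize f"
| "fsize (NextMu f) = 1 + fsize f"
| "fsize (Prev f) = 1 + fsize f"
| "fsize (PrevMu f) = 1 + fsize f"
| "fsize (Until K f g) = 1 + fsize f + fsize g"
| "fsize (Since K f g) = 1 + fsize f + fsize g"
| "fsize (Within f) = 1 + fsize f"

definition equivalent :: "'p set \<Rightarrow> 'p fm \<Rightarrow> 'p fm \<Rightarrow> bool" where
  "equivalent A f g \<longleftrightarrow> (\<forall>w. nested_omega_word A w \<longrightarrow> (sat w 1 f \<longleftrightarrow> sat w 1 g))"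

definition nwtl_plus_equivalents :: "'p set \<Rightarrow> 'p fm \<Rightarrow> 'p fm set" where
  "nwtl_plus_equivalents A f = {g. nwtl_plus g \<and> props g \<subseteq> A \<and> equivalent A f g}"

text \<open>Meaningful only if \<open>nwtl_plus_equivalents A f\<close> is nonempty.\<close>

definition min_nwtl_plus_size :: "'p set \<Rightarrow> 'p fm \<Rightarrow> nat" where
  "min_nwtl_plus_size A f = (LEAST s. \<exists>g\<in>nwtl_plus_equivalents A f. s = fsize g)"

end

theory Submission
  imports Defs
begin

text \<open>
  At an unmatched call the operator \<open>\<W>\<close> forgets the past. Over words all of whose positions are
  calls and none is a return, a formula of linear size can therefore say that any two positions
  agreeing on the propositions \<open>1, \<dots>, n\<close> also agree on \<open>0\<close>: cut the word at the earlier position,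
  which then can be referred to as the first one.

  Over such words \<open>NWTL\<^sup>+\<close> is just LTL with past. If two words agree on all subformulas of \<open>g\<close> at
  the two positions next to a cut, then replacing the part of one word after the cut by that of the
  other preserves the truth of these subformulas. There are \<open>2 ^ 2 ^ n\<close> ways of choosing \<open>0\<close> as a
  function of \<open>1, \<dots>, n\<close>, and each gives a periodic model. Two different ones never glue to a
  model, so a formula \<open>g\<close> defining the property needs at least \<open>2 ^ n / 2\<close> subformulas.
\<close>

section \<open>Derived connectives\<close>

text \<open>A linear step determines its successor, so entry \<open>p\<close> is
  \<open>i + p\<close> and the list is forced. This turns the quantifier over paths in
  \<open>sat\<close> into one over end positions.\<close>

lemma is_path_Linear:
  "is_path w Linear i j xs \<longleftrightarrow> i \<le> j \<and> {i..j} \<subseteq> pos w \<and> xs = [i..<Suc j]"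
proof
  assume p: "is_path w Linear i j xs"
  then have ne: "xs \<noteq> []" and hd: "hd xs = i" and last: "last xs = j"
    and step: "\<And>p. p + 1 < length xs \<Longrightarrow> xs ! (p + 1) = xs ! p + 1"
    by (auto simp: is_path_def)
  have nth: "xs ! p = i + p" if "p < length xs" for p
    using that
  proof (induction p)
    case 0
    then show ?case using hd ne by (simp add: hd_conv_nth)
  next
    case (Suc p)
    then show ?case using step[of p] by simp
  qed
  have len: "j = i + (length xs - 1)"
    using nth[of "length xs - 1"] ne last by (simp add: last_conv_nth)
  have "length xs = Suc j - i"
  proof -
    have "length xs > 0" using ne by simp
    then show ?thesis using len by linarith
  qed
  then have xs: "xs = [i..<Suc j]"
    using nth by (intro nth_equalityI) (auto simp del: upt_Suc)
  then have "set xs = {i..j}" by auto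
  moreover have "set xs \<subseteq> pos w" using p by (simp add: is_path_def)
  moreover have "i \<le> j" using len by linarith
  ultimately show "i \<le> j \<and> {i..j} \<subseteq> pos w \<and> xs = [i..<Suc j]"
    using xs by blast
next
  assume "i \<le> j \<and> {i..j} \<subseteq> pos w \<and> xs = [i..<Suc j]"
  then have ij: "i \<le> j" and pos: "{i..j} \<subseteq> pos w" and xs: "xs = [i..<Suc j]" by blast+
  have "set xs = {i..j}" unfolding xs set_upt by (rule atLeastLessThanSuc_atLeastAtMost)
  moreover have "[i..<Suc j] ! (p + 1) = [i..<Suc j] ! p + 1"
    if "p + 1 < length [i..<Suc j]" for p
  proof -
    have "i + (p + 1) < Suc j" "i + p < Suc j" using that unfolding length_upt by linarith+
    then show ?thesis by (simp only: nth_upt add.assoc)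
  qed
  moreover have "hd [i..<Suc j] = i" "last [i..<Suc j] = j" "[i..<Suc j] \<noteq> []"
    using ij by (simp_all add: hd_append)
  ultimately show "is_path w Linear i j xs"
    using pos unfolding is_path_def path_step.simps xs by blast
qed

lemma sat_Until_Linear:
  "sat w i (Until Linear f g) \<longleftrightarrow>
     (\<exists>j\<ge>i. {i..j} \<subseteq> pos w \<and> sat w j g \<and> (\<forall>k. i \<le> k \<and> k < j \<longrightarrow> sat w k f))"
proof -
  have "(\<forall>p. p + 1 < length [i..<Suc j] \<longrightarrow> sat w ([i..<Suc j] ! p) f) \<longleftrightarrow>
      (\<forall>k. i \<le> k \<and> k < j \<longrightarrow> sat w k f)" if "i \<le> j" for j
  proof -
    have "(\<forall>p. p + 1 < length [i..<Suc j] \<longrightarrow> sat w ([i..<Suc j] ! p) f) \<longleftrightarrow>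
      (\<forall>p. i + p < j \<longrightarrow> sat w (i + p) f)"
      by (auto simp del: upt_Suc)
    also have "\<dots> \<longleftrightarrow> (\<forall>k. i \<le> k \<and> k < j \<longrightarrow> sat w k f)"
      by (metis le_Suc_ex le_add1)
    finally show ?thesis .
  qed
  then show ?thesis
    unfolding sat.simps is_path_Linear by blast
qed

lemma sat_Since_Linear:
  "sat w i (Since Linear f g) \<longleftrightarrow>
     (\<exists>j\<le>i. {j..i} \<subseteq> pos w \<and> sat w j g \<and> (\<forall>k. j < k \<and> k \<le> i \<longrightarrow> sat w k f))"
proof -
  have "(\<forall>p. 0 < p \<and> p < length [j..<Suc i] \<longrightarrow> sat w ([j..<Suc i] ! p) f) \<longleftrightarrow>
      (\<forall>k. j < k \<and> k \<le> i \<longrightarrow> sat w k f)" if "j \<le> i" for j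
  proof -
    have "(\<forall>p. 0 < p \<and> p < length [j..<Suc i] \<longrightarrow> sat w ([j..<Suc i] ! p) f) \<longleftrightarrow>
      (\<forall>p. 0 < p \<and> j + p \<le> i \<longrightarrow> sat w (j + p) f)"
      by (auto simp del: upt_Suc)
    also have "\<dots> \<longleftrightarrow> (\<forall>k. j < k \<and> k \<le> i \<longrightarrow> sat w k f)"
      by (metis less_add_same_cancel1 less_imp_add_positive)
    finally show ?thesis .
  qed
  then show ?thesis
    unfolding sat.simps is_path_Linear by blast
qed

section \<open>Abbreviations: truth, size and propositions\<close>

definition And :: "'p fm \<Rightarrow> 'p fm \<Rightarrow> 'p fm" where
  "And f g = Neg (Or (Neg f) (Neg g))"

definition Imp :: "'p fm \<Rightarrow> 'p fm \<Rightarrow> 'p fm" where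
  "Imp f g = Or (Neg f) g"

definition Iff :: "'p fm \<Rightarrow> 'p fm \<Rightarrow> 'p fm" where
  "Iff f g = And (Imp f g) (Imp g f)"

definition Globally :: "'p fm \<Rightarrow> 'p fm" where
  "Globally f = Neg (Until Linear Truth (Neg f))"

text \<open>Only the first position of a word satisfies \<open>Neg (Prev Truth)\<close>; after a cut
  by \<open>Within\<close> this is the cut position, so it can be referred to from any later
  position.\<close>

definition Initially :: "'p fm \<Rightarrow> 'p fm" where
  "Initially f = Since Linear Truth (And (Neg (Prev Truth)) f)"

definition Conj :: "'p fm list \<Rightarrow> 'p fm" where
  "Conj fs = foldr And fs Truth"

lemma sat_And [simp]: "sat w i (And f g) \<longleftrightarrow> sat w i f \<and> sat w i g"
  and sat_Imp [simp]: "sat w i (Imp f g) \<longleftrightarrow> (sat w i f \<longrightarrow> sat w i g)"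
  and sat_Iff [simp]: "sat w i (Iff f g) \<longleftrightarrow> (sat w i f \<longleftrightarrow> sat w i g)"
  by (auto simp: And_def Imp_def Iff_def)

lemma sat_Conj [simp]: "sat w i (Conj fs) \<longleftrightarrow> (\<forall>f\<in>set fs. sat w i f)"
  by (induction fs) (auto simp: Conj_def)

text \<open>Stated for positions \<open>{a..}\<close> so as to serve both whole words and the
  suffixes produced by \<open>Within\<close>.\<close>

lemma sat_Globally:
  assumes "pos w = {a..}" "a \<le> i"
  shows "sat w i (Globally f) \<longleftrightarrow> (\<forall>j\<ge>i. sat w j f)"
  using assms unfolding Globally_def sat.simps(5) sat_Until_Linear by auto

lemma sat_Initially:
  assumes "pos w = {a..}" "1 \<le> a" "a \<le> i"
  shows "sat w i (Initially f) \<longleftrightarrow> sat w a f"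
proof -
  \<comment> \<open>\<open>1 \<le> a\<close> makes \<open>a - 1\<close> a true predecessor outside
    \<open>{a..}\<close>; with truncated subtraction \<open>0 - 1\<close> would be
    \<open>0\<close>.\<close>
  have first: "j \<le> i \<and> a \<le> j \<and> \<not> a \<le> j - 1 \<longleftrightarrow> j = a" for j
    using assms(2,3) by linarith
  have "sat w i (Initially f) \<longleftrightarrow> (\<exists>j. (j \<le> i \<and> a \<le> j \<and> \<not> a \<le> j - 1) \<and> sat w j f)"
    using assms unfolding Initially_def sat_Since_Linear by auto
  also have "\<dots> \<longleftrightarrow> sat w a f"
    unfolding first by simp
  finally show ?thesis .
qed

lemma fsize_And [simp]: "fsize (And f g) = 4 + fsize f + fsize g"
  and fsize_Imp [simp]: "fsize (Imp f g) = 2 + fsize f + fsize g"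
  and fsize_Iff [simp]: "fsize (Iff f g) = 8 + 2 * fsize f + 2 * fsize g"
  and fsize_Globally [simp]: "fsize (Globally f) = 4 + fsize f"
  and fsize_Initially [simp]: "fsize (Initially f) = 9 + fsize f"
  by (auto simp: And_def Imp_def Iff_def Globally_def Initially_def)

lemma fsize_Conj: "fsize (Conj fs) = 1 + (\<Sum>f\<leftarrow>fs. 4 + fsize f)"
  by (induction fs) (auto simp: Conj_def)

lemma props_And [simp]: "props (And f g) = props f \<union> props g"
  and props_Imp [simp]: "props (Imp f g) = props f \<union> props g"
  and props_Iff [simp]: "props (Iff f g) = props f \<union> props g"
  and props_Globally [simp]: "props (Globally f) = props f"
  and props_Initially [simp]: "props (Initially f) = props f"
  by (auto simp: And_def Imp_def Iff_def Globally_def Initially_def)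

lemma props_Conj [simp]: "props (Conj fs) = (\<Union>f\<in>set fs. props f)"
  by (induction fs) (auto simp: Conj_def)

lemma nwtl_plus_And [simp]: "nwtl_plus (And f g) \<longleftrightarrow> nwtl_plus f \<and> nwtl_plus g"
  and nwtl_plus_Imp [simp]: "nwtl_plus (Imp f g) \<longleftrightarrow> nwtl_plus f \<and> nwtl_plus g"
  and nwtl_plus_Globally [simp]: "nwtl_plus (Globally f) \<longleftrightarrow> nwtl_plus f"
  by (auto simp: And_def Imp_def Globally_def)

lemma nwtl_plus_Conj [simp]: "nwtl_plus (Conj fs) \<longleftrightarrow> (\<forall>f\<in>set fs. nwtl_plus f)"
  by (induction fs) (auto simp: Conj_def)

section \<open>The formulas\<close>

text \<open>The pair is ordered because a cut at \<open>i\<close> shows only the positions from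
  \<open>i\<close> on; the compared condition is symmetric, so all pairs are covered.\<close>

definition functional_labels :: "nat \<Rightarrow> (nat \<Rightarrow> nat set) \<Rightarrow> bool" where
  "functional_labels n L \<longleftrightarrow>
     (\<forall>i\<ge>1. \<forall>j\<ge>i. L i \<inter> {1..n} = L j \<inter> {1..n} \<longrightarrow> (0 \<in> L i \<longleftrightarrow> 0 \<in> L j))"

definition as_initially :: "'p \<Rightarrow> 'p fm" where
  "as_initially p = Iff (Atom p) (Initially (Atom p))"

text \<open>\<open>Within\<close> fails at non-calls, so the second conjunct also makes every
  position a call. Without returns these calls are unmatched, and each cut leaves the whole suffix,
  whose first letter is compared with all later ones.\<close>

definition succinct_fm :: "nat \<Rightarrow> nat fm" where
  "succinct_fm n =
     And (Globally (Neg IsRet))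
       (Globally (Within (Globally
         (Imp (Conj (map as_initially [1..<Suc n])) (as_initially 0)))))"

text \<open>Letters are given as lists because \<open>subseqs\<close> enumerates the subsets of
  \<open>{1..n}\<close> in this form.\<close>

definition letter_fm :: "nat \<Rightarrow> nat list \<Rightarrow> nat fm" where
  "letter_fm n ps =
     Conj (map (\<lambda>k. if k \<in> set ps then Atom k else Neg (Atom k)) [1..<Suc n])"

text \<open>An exponentially long equivalent of \<open>succinct_fm n\<close> without
  \<open>Within\<close>: one conjunct per letter spells out that \<open>0\<close> is constant on the
  positions carrying this letter. It guarantees that the minimal size ranges over a nonempty
  set.\<close>

definition plain_fm :: "nat \<Rightarrow> nat fm" where
  "plain_fm n =
     And (Globally (Neg IsRet)) (And (Globally IsCall)
       (Conj (map (\<lambda>ps. Or (Globally (Imp (letter_fm n ps) (Atom 0)))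
                           (Globally (Imp (letter_fm n ps) (Neg (Atom 0)))))
         (subseqs [1..<Suc n]))))"

text \<open>A conjunct \<open>as_initially p\<close> has size 30, its \<open>And\<close> adds 4, and
  there are \<open>n\<close> of them; everything else is constant.\<close>

lemma fsize_succinct_fm: "fsize (succinct_fm n) = 52 + 34 * n"
proof -
  have "fsize (as_initially p) = 30" for p :: nat
    by (simp add: as_initially_def)
  then show ?thesis
    by (simp add: succinct_fm_def fsize_Conj comp_def sum_list_triv del: upt_Suc)
qed

section \<open>Models of the two formulas\<close>

lemma sat_letter_fm:
  assumes "set ps \<subseteq> {1..n}"
  shows "sat w i (letter_fm n ps) \<longleftrightarrow> lab w i \<inter> {1..n} = set ps"
proof -
  have "sat w i (letter_fm n ps) \<longleftrightarrow> (\<forall>k\<in>{1..n}. k \<in> set ps \<longleftrightarrow> k \<in> lab w i)"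
    by (auto simp: letter_fm_def simp del: upt_Suc if_image_distrib split: if_splits)
  also have "\<dots> \<longleftrightarrow> lab w i \<inter> {1..n} = set ps"
    using assms by blast
  finally show ?thesis .
qed

lemma sat_succinct_fm:
  assumes w: "nested_omega_word A w"
  shows "sat w 1 (succinct_fm n) \<longleftrightarrow>
    (\<forall>i\<ge>1. call w i \<and> \<not> ret w i) \<and> functional_labels n (lab w)"
proof -
  have pos: "pos w = {1..}" using w by (simp add: nested_omega_word_def)
  define \<psi> where "\<psi> = Globally (Imp (Conj (map as_initially [1..<Suc n])) (as_initially 0))"
  have within: "sat w i (Within \<psi>) \<longleftrightarrow> call w i \<and>
      (\<forall>j\<ge>i. lab w i \<inter> {1..n} = lab w j \<inter> {1..n} \<longrightarrow> (0 \<in> lab w i \<longleftrightarrow> 0 \<in> lab w j))"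
    if i: "1 \<le> i" and nr: "\<forall>i\<ge>1. \<not> ret w i" for i
  proof -
    let ?v = "subword w {i..}"
    \<comment> \<open>Without returns the call at \<open>i\<close> is unmatched, so
      \<open>Within\<close> evaluates in the suffix \<open>?v\<close> rather than in a finite
      subword.\<close>
    have nm: "\<not> matched_call w i"
    proof
      assume "matched_call w i"
      then obtain j where "mu w i j" by (auto simp: matched_call_def)
      then have "ret w j" "i < j"
        using w by (auto simp: nested_omega_word_def matching_def)
      with nr i show False by auto
    qed
    have v: "pos ?v = {i..}" "lab ?v = lab w"
      using i by (simp_all add: subword_def pos Int_absorb1)
    have ini: "sat ?v j (as_initially p) \<longleftrightarrow> (p \<in> lab w j \<longleftrightarrow> p \<in> lab w i)" if "i \<le> j" for j p
      using sat_Initially[OF v(1) i that] v(2) by (simp add: as_initially_def)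
    have letter: "lab w i \<inter> {1..n} = lab w j \<inter> {1..n} \<longleftrightarrow>
        (\<forall>p\<in>{1..n}. p \<in> lab w j \<longleftrightarrow> p \<in> lab w i)" for j
      by blast
    have "sat ?v j (Conj (map as_initially [1..<Suc n])) \<longleftrightarrow>
        lab w i \<inter> {1..n} = lab w j \<inter> {1..n}" if "i \<le> j" for j
      unfolding letter sat_Conj set_map
      by (simp add: ini[OF that] atLeastLessThanSuc_atLeastAtMost del: upt_Suc)
    then have "sat ?v i \<psi> \<longleftrightarrow> (\<forall>j\<ge>i. lab w i \<inter> {1..n} = lab w j \<inter> {1..n} \<longrightarrow>
        (0 \<in> lab w j \<longleftrightarrow> 0 \<in> lab w i))"
      unfolding \<psi>_def sat_Globally[OF v(1) order_refl] sat_Imp using ini by simp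
    then show ?thesis using nm by auto
  qed
  have glob: "sat w 1 (succinct_fm n) \<longleftrightarrow>
      (\<forall>i\<ge>1. \<not> ret w i) \<and> (\<forall>i\<ge>1. sat w i (Within \<psi>))"
    unfolding succinct_fm_def \<psi>_def sat_And sat_Globally[OF pos order_refl] sat.simps(4,5) ..
  show ?thesis
  \<comment> \<open>\<open>within\<close> is available only without returns; otherwise both sides
    are false.\<close>
  proof (cases "\<forall>i\<ge>1. \<not> ret w i")
    case True
    have "(\<forall>i\<ge>1. sat w i (Within \<psi>)) \<longleftrightarrow> (\<forall>i\<ge>1. call w i) \<and> functional_labels n (lab w)"
      unfolding functional_labels_def by (simp add: within[OF _ True] del: sat.simps) blast
    with True show ?thesis unfolding glob by blast
  next
    case False
    then show ?thesis unfolding glob by blast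
  qed
qed

lemma sat_plain_fm:
  assumes w: "nested_omega_word A w"
  shows "sat w 1 (plain_fm n) \<longleftrightarrow>
    (\<forall>i\<ge>1. call w i \<and> \<not> ret w i) \<and> functional_labels n (lab w)"
proof -
  have pos: "pos w = {1..}" using w by (simp add: nested_omega_word_def)
  let ?P = "\<lambda>s. (\<forall>i\<ge>1. lab w i \<inter> {1..n} = s \<longrightarrow> 0 \<in> lab w i) \<or>
      (\<forall>i\<ge>1. lab w i \<inter> {1..n} = s \<longrightarrow> 0 \<notin> lab w i)"
  have pow: "set ` set (subseqs [1..<Suc n]) = Pow {1..n}"
    using subseqs_powset[of "[1..<Suc n]"] by (simp add: atLeastLessThanSuc_atLeastAtMost del: upt_Suc)
  then have sub: "set ps \<subseteq> {1..n}" if "ps \<in> set (subseqs [1..<Suc n])" for ps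
    using that by blast
  have "sat w 1 (plain_fm n) \<longleftrightarrow> (\<forall>i\<ge>1. call w i \<and> \<not> ret w i) \<and>
      (\<forall>ps\<in>set (subseqs [1..<Suc n]). ?P (set ps))"
    using sub by (auto simp: plain_fm_def sat_Globally[OF pos] sat_letter_fm simp del: upt_Suc)
  moreover have "(\<forall>ps\<in>set (subseqs [1..<Suc n]). ?P (set ps)) \<longleftrightarrow> (\<forall>s\<in>Pow {1..n}. ?P s)"
    unfolding pow[symmetric] by (simp del: upt_Suc)
  moreover have "(\<forall>s\<in>Pow {1..n}. ?P s) \<longleftrightarrow> functional_labels n (lab w)"
  proof
    assume P: "\<forall>s\<in>Pow {1..n}. ?P s"
    show "functional_labels n (lab w)"
      unfolding functional_labels_def
    proof (intro allI impI)
      fix i j :: nat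
      assume ij: "1 \<le> i" "i \<le> j" "lab w i \<inter> {1..n} = lab w j \<inter> {1..n}"
      have "?P (lab w i \<inter> {1..n})" using P by blast
      moreover have "1 \<le> j" using ij by simp
      ultimately show "0 \<in> lab w i \<longleftrightarrow> 0 \<in> lab w j"
        using ij(1) ij(3)[symmetric] by blast
    qed
  next
    assume F: "functional_labels n (lab w)"
    \<comment> \<open>Removes the ordering \<open>i \<le> j\<close> of
      \<open>functional_labels\<close> by symmetry.\<close>
    have same: "0 \<in> lab w i \<longleftrightarrow> 0 \<in> lab w j"
      if "1 \<le> i" "1 \<le> j" "lab w i \<inter> {1..n} = lab w j \<inter> {1..n}" for i j
      using F that nat_le_linear[of i j] unfolding functional_labels_def by fastforce
    show "\<forall>s\<in>Pow {1..n}. ?P s"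
    proof
      fix s
      show "?P s" using same by blast
    qed
  qed
  ultimately show ?thesis by simp
qed

text \<open>Both formulas have been given the same characterisation of their models.\<close>

lemma plain_fm_in_equivalents: "plain_fm n \<in> nwtl_plus_equivalents {0..n} (succinct_fm n)"
proof -
  have "nwtl_plus (letter_fm n ps)" "props (letter_fm n ps) \<subseteq> {0..n}" for ps
    by (auto simp: letter_fm_def simp del: upt_Suc)
  then have "nwtl_plus (plain_fm n)" "props (plain_fm n) \<subseteq> {0..n}"
    by (auto simp: plain_fm_def simp del: upt_Suc)
  then show ?thesis
    by (simp add: nwtl_plus_equivalents_def equivalent_def sat_succinct_fm sat_plain_fm del: One_nat_def)
qed

section \<open>Gluing words without returns\<close>

text \<open>\<open>call\<close> starts at 1 because a matching may put calls only at positions of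
  the word.\<close>

definition call_word :: "(nat \<Rightarrow> 'p set) \<Rightarrow> 'p nword" where
  "call_word L = \<lparr>pos = {1..}, lab = L, call = (\<lambda>i. 1 \<le> i), ret = (\<lambda>i. False), mu = (\<lambda>i j. False)\<rparr>"

lemma call_word_simps [simp]:
  "pos (call_word L) = {1..}" "lab (call_word L) = L" "call (call_word L) i \<longleftrightarrow> 1 \<le> i"
  "ret (call_word L) i \<longleftrightarrow> False" "mu (call_word L) i j \<longleftrightarrow> False"
  "matched_call (call_word L) i \<longleftrightarrow> False" "innermost_call (call_word L) i j \<longleftrightarrow> False"
  by (simp_all add: call_word_def matched_call_def innermost_call_def)

lemma nested_omega_word_call_word:
  "(\<And>i. 1 \<le> i \<Longrightarrow> L i \<subseteq> A) \<Longrightarrow> nested_omega_word A (call_word L)"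
  by (auto simp: nested_omega_word_def matching_def)

text \<open>No call is matched, so a summary path never jumps.\<close>

lemma is_path_Summary_call_word:
  "is_path (call_word L) Summary i j xs \<longleftrightarrow> is_path (call_word L) Linear i j xs"
  by (simp add: is_path_def)

text \<open>A call path needs an enclosing matched call, and an abstract path leaves a position only
  by a matched call or from a non-call. Neither exists here, so no step is possible.\<close>

lemma is_path_stuck_call_word:
  assumes "K = CallPath \<or> K = Abstract"
  shows "is_path (call_word L) K i j xs \<longleftrightarrow> 1 \<le> i \<and> j = i \<and> xs = [i]"
proof
  assume p: "is_path (call_word L) K i j xs"
  have "\<not> 1 < length xs"
  proof
    assume l: "1 < length xs"
    with p have "path_step (call_word L) K j (xs ! 0) (xs ! 1)"
      unfolding is_path_def by (metis One_nat_def add_0)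
    \<comment> \<open>Index 0 is not a call, so \<open>path_step\<close> would let an abstract path
      leave it; this is excluded since path entries are positions.\<close>
    moreover have "1 \<le> xs ! 0"
    proof -
      have "xs ! 0 \<in> set xs" using l by (intro nth_mem) linarith
      moreover have "set xs \<subseteq> {1..}" using p by (simp add: is_path_def)
      ultimately have "xs ! 0 \<in> {1..}" by blast
      then show ?thesis by simp
    qed
    ultimately show False using assms by auto
  qed
  then have "length xs = 1"
    using p by (cases xs) (auto simp: is_path_def)
  then obtain x where "xs = [x]" by (auto simp: length_Suc_conv)
  with p show "1 \<le> i \<and> j = i \<and> xs = [i]" by (auto simp: is_path_def)
qed (auto simp: is_path_def)

text \<open>On these words every until is the usual LTL until or collapses to its second
  argument.\<close>

lemma sat_Until_call_word:
  assumes "1 \<le> i"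
  shows "sat (call_word L) i (Until K f g) \<longleftrightarrow>
    (if K = Linear \<or> K = Summary
     then \<exists>j\<ge>i. sat (call_word L) j g \<and> (\<forall>k. i \<le> k \<and> k < j \<longrightarrow> sat (call_word L) k f)
     else sat (call_word L) i g)"
proof (cases "K = Linear \<or> K = Summary")
  case True
  then have "sat (call_word L) i (Until K f g) \<longleftrightarrow> sat (call_word L) i (Until Linear f g)"
    unfolding sat.simps using is_path_Summary_call_word by metis
  then show ?thesis
    using True assms unfolding sat_Until_Linear by auto
next
  case False
  then have "K = CallPath \<or> K = Abstract" by (cases K) auto
  then show ?thesis
    using False assms by (auto simp: is_path_stuck_call_word)
qed

lemma sat_Since_call_word:
  assumes "1 \<le> i"
  shows "sat (call_word L) i (Since K f g) \<longleftrightarrow>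
    (if K = Linear \<or> K = Summary
     then \<exists>j\<le>i. 1 \<le> j \<and> sat (call_word L) j g \<and> (\<forall>k. j < k \<and> k \<le> i \<longrightarrow> sat (call_word L) k f)
     else sat (call_word L) i g)"
proof (cases "K = Linear \<or> K = Summary")
  case True
  then have "sat (call_word L) i (Since K f g) \<longleftrightarrow> sat (call_word L) i (Since Linear f g)"
    unfolding sat.simps using is_path_Summary_call_word by metis
  then show ?thesis
    using True assms unfolding sat_Since_Linear by auto
next
  case False
  then have "K = CallPath \<or> K = Abstract" by (cases K) auto
  then show ?thesis
    using False assms by (auto simp: is_path_stuck_call_word)
qed

section \<open>Subformulas, and splitting until and since at a cut\<close>

primrec subfms :: "'p fm \<Rightarrow> 'p fm set" where
  "subfms Truth = {Truth}"
| "subfms (Atom p) = {Atom p}"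
| "subfms IsCall = {IsCall}"
| "subfms IsRet = {IsRet}"
| "subfms (Neg f) = insert (Neg f) (subfms f)"
| "subfms (Or f g) = insert (Or f g) (subfms f \<union> subfms g)"
| "subfms (Next f) = insert (Next f) (subfms f)"
| "subfms (NextMu f) = insert (NextMu f) (subfms f)"
| "subfms (Prev f) = insert (Prev f) (subfms f)"
| "subfms (PrevMu f) = insert (PrevMu f) (subfms f)"
| "subfms (Until K f g) = insert (Until K f g) (subfms f \<union> subfms g)"
| "subfms (Since K f g) = insert (Since K f g) (subfms f \<union> subfms g)"
| "subfms (Within f) = insert (Within f) (subfms f)"

lemma finite_subfms: "finite (subfms f)"
  by (induction f) auto

text \<open>\<open>fsize\<close> counts occurrences, \<open>subfms\<close> each distinct subformula
  once.\<close>

lemma card_subfms_le: "card (subfms f) \<le> fsize f"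
proof (induction f)
  case (Or f g)
  then show ?case
    using card_Un_le[of "subfms f" "subfms g"] by (simp add: card_insert_if finite_subfms)
next
  case (Until K f g)
  then show ?case
    using card_Un_le[of "subfms f" "subfms g"] by (simp add: card_insert_if finite_subfms)
next
  case (Since K f g)
  then show ?case
    using card_Un_le[of "subfms f" "subfms g"] by (simp add: card_insert_if finite_subfms)
qed (auto simp: card_insert_if finite_subfms)

text \<open>\<open>M\<close> is not shifted: both words are cut after the same position and keep
  their numbering.\<close>

definition glue :: "nat \<Rightarrow> (nat \<Rightarrow> 'a) \<Rightarrow> (nat \<Rightarrow> 'a) \<Rightarrow> nat \<Rightarrow> 'a" where
  "glue N L M i = (if i \<le> N then L i else M i)"

text \<open>Either the witness comes before the cut, or the until holds afresh at
  \<open>Suc N\<close>. Thus the part after the cut enters only through one truth value at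
  \<open>Suc N\<close>.\<close>

lemma until_split:
  fixes i N :: nat
  assumes "i \<le> N"
  shows "(\<exists>j\<ge>i. Q j \<and> (\<forall>k. i \<le> k \<and> k < j \<longrightarrow> P k)) \<longleftrightarrow>
    (\<exists>j\<ge>i. j \<le> N \<and> Q j \<and> (\<forall>k. i \<le> k \<and> k < j \<longrightarrow> P k)) \<or>
    (\<forall>k. i \<le> k \<and> k \<le> N \<longrightarrow> P k) \<and> (\<exists>j\<ge>Suc N. Q j \<and> (\<forall>k. Suc N \<le> k \<and> k < j \<longrightarrow> P k))"
  (is "?L \<longleftrightarrow> ?R1 \<or> ?R2")
proof
  assume ?L
  then obtain j where j: "i \<le> j" "Q j" "\<And>k. i \<le> k \<Longrightarrow> k < j \<Longrightarrow> P k" by blast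
  show "?R1 \<or> ?R2"
  proof (cases "j \<le> N")
    case True
    with j show ?thesis by blast
  next
    case False
    then have "\<forall>k. i \<le> k \<and> k \<le> N \<longrightarrow> P k" using j by auto
    moreover have "\<forall>k. Suc N \<le> k \<and> k < j \<longrightarrow> P k" using j assms by auto
    ultimately show ?thesis using j False by (metis not_less_eq_eq)
  qed
next
  assume "?R1 \<or> ?R2"
  then show ?L
  proof
    assume ?R2
    then obtain j where j: "Suc N \<le> j" "Q j" "\<And>k. Suc N \<le> k \<Longrightarrow> k < j \<Longrightarrow> P k"
      and P: "\<And>k. i \<le> k \<Longrightarrow> k \<le> N \<Longrightarrow> P k" by blast
    then have "\<forall>k. i \<le> k \<and> k < j \<longrightarrow> P k" by (metis not_less_eq_eq)
    with j assms show ?L by (metis Suc_leD le_trans)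
  qed blast
qed

text \<open>Mirror image: the part before the cut enters only through the since at
  \<open>N\<close>.\<close>

lemma since_split:
  fixes i N :: nat
  assumes "1 \<le> N" "N < i"
  shows "(\<exists>j\<le>i. 1 \<le> j \<and> Q j \<and> (\<forall>k. j < k \<and> k \<le> i \<longrightarrow> P k)) \<longleftrightarrow>
    (\<exists>j\<le>i. N < j \<and> Q j \<and> (\<forall>k. j < k \<and> k \<le> i \<longrightarrow> P k)) \<or>
    (\<forall>k. N < k \<and> k \<le> i \<longrightarrow> P k) \<and>
      (\<exists>j\<le>N. 1 \<le> j \<and> Q j \<and> (\<forall>k. j < k \<and> k \<le> N \<longrightarrow> P k))"
  (is "?L \<longleftrightarrow> ?R1 \<or> ?R2")
proof
  assume ?L
  then obtain j where j: "j \<le> i" "1 \<le> j" "Q j" "\<And>k. j < k \<Longrightarrow> k \<le> i \<Longrightarrow> P k" by blast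
  show "?R1 \<or> ?R2"
  proof (cases "N < j")
    case True
    with j show ?thesis by blast
  next
    case False
    then have "\<forall>k. N < k \<and> k \<le> i \<longrightarrow> P k" using j by auto
    moreover have "\<forall>k. j < k \<and> k \<le> N \<longrightarrow> P k" using j assms by auto
    ultimately show ?thesis using j False by (metis not_less)
  qed
next
  assume "?R1 \<or> ?R2"
  then show ?L
  proof
    assume ?R1
    then show ?L using assms by (metis less_imp_le order.trans)
  next
    assume ?R2
    then obtain j where j: "j \<le> N" "1 \<le> j" "Q j" "\<And>k. j < k \<Longrightarrow> k \<le> N \<Longrightarrow> P k"
      and P: "\<And>k. N < k \<Longrightarrow> k \<le> i \<Longrightarrow> P k" by blast
    then have "\<forall>k. j < k \<and> k \<le> i \<longrightarrow> P k" by (metis not_less)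
    with j assms show ?L by (metis less_imp_le order.trans)
  qed
qed

text \<open>Induction on \<open>f\<close>. Only operators looking across the cut matter:
  \<open>Next\<close> and \<open>Until\<close> need agreement at \<open>Suc N\<close>,
  \<open>Prev\<close> and \<open>Since\<close> at \<open>N\<close>. Agreement on all subformulas
  lets the hypotheses pass to the arguments.\<close>

lemma sat_glue:
  fixes L M :: "nat \<Rightarrow> 'p set"
  assumes "nwtl_plus f" "1 \<le> N"
    and "\<And>h. h \<in> subfms f \<Longrightarrow> sat (call_word L) N h \<longleftrightarrow> sat (call_word M) N h"
    and "\<And>h. h \<in> subfms f \<Longrightarrow> sat (call_word L) (Suc N) h \<longleftrightarrow> sat (call_word M) (Suc N) h"
    and "1 \<le> i"
  shows "sat (call_word (glue N L M)) i f \<longleftrightarrow>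
    (if i \<le> N then sat (call_word L) i f else sat (call_word M) i f)"
  using assms
proof (induction f arbitrary: i)
  case (Next f)
  note IH = Next.IH[of "Suc i"]
  show ?case
  proof (cases "i = N")
    case True
    \<comment> \<open>From \<open>N\<close> the glued word looks into \<open>M\<close> while the
      claim concerns \<open>L\<close>; the agreement at \<open>Suc N\<close> bridges this.\<close>
    have "f \<in> subfms (Next f)" by (cases f) auto
    then have "sat (call_word L) (Suc N) f \<longleftrightarrow> sat (call_word M) (Suc N) f"
      by (rule Next.prems(4))
    then show ?thesis using True IH Next.prems by simp
  next
    case False
    then have "Suc i \<le> N \<longleftrightarrow> i \<le> N" by auto
    then show ?thesis using IH Next.prems by auto
  qed
next
  case (Prev f)
  show ?case
  proof (cases "i = 1")
    case True
    then show ?thesis by simp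
  next
    case False
    then obtain k where k: "i = Suc k" "1 \<le> k"
      using Prev.prems(5) by (cases i) auto
    have IH: "sat (call_word (glue N L M)) k f \<longleftrightarrow>
        (if k \<le> N then sat (call_word L) k f else sat (call_word M) k f)"
      using Prev.IH[of k] Prev.prems k by auto
    show ?thesis
    proof (cases "k = N")
      case True
      have "f \<in> subfms (Prev f)" by (cases f) auto
      then have "sat (call_word L) N f \<longleftrightarrow> sat (call_word M) N f"
        by (rule Prev.prems(3))
      then show ?thesis using True IH k by simp
    next
      case False
      then have "Suc k \<le> N \<longleftrightarrow> k \<le> N" by auto
      then show ?thesis using IH k by simp
    qed
  qed
next
  case (Until K f g)
  let ?G = "call_word (glue N L M)" and ?L = "call_word L" and ?M = "call_word M"
  have f: "sat ?G k f \<longleftrightarrow> (if k \<le> N then sat ?L k f else sat ?M k f)"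
    and g: "sat ?G k g \<longleftrightarrow> (if k \<le> N then sat ?L k g else sat ?M k g)" if "1 \<le> k" for k
    using Until.IH(1)[of k] Until.IH(2)[of k] Until.prems that by auto
  have at: "sat ?L (Suc N) (Until K f g) \<longleftrightarrow> sat ?M (Suc N) (Until K f g)"
    by (rule Until.prems(4)) simp
  show ?case
  proof (cases "K = Linear \<or> K = Summary")
    case False
    then show ?thesis using g[of i] Until.prems(5) by (simp add: sat_Until_call_word del: sat.simps)
  next
    case K: True
    note U = sat_Until_call_word[of _ _ K f g]
    have tail: "(\<exists>j\<ge>a. sat ?G j g \<and> (\<forall>k. a \<le> k \<and> k < j \<longrightarrow> sat ?G k f)) \<longleftrightarrow>
        (\<exists>j\<ge>a. sat ?M j g \<and> (\<forall>k. a \<le> k \<and> k < j \<longrightarrow> sat ?M k f))" if "N < a" for a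
      using f g that by (intro ex_cong1) auto
    show ?thesis
    proof (cases "i \<le> N")
      case False
      then show ?thesis using U[OF \<open>1 \<le> i\<close>] K tail[of i] by (simp del: sat.simps)
    next
      case True
      have head: "(\<exists>j\<ge>i. j \<le> N \<and> sat ?G j g \<and> (\<forall>k. i \<le> k \<and> k < j \<longrightarrow> sat ?G k f)) \<longleftrightarrow>
          (\<exists>j\<ge>i. j \<le> N \<and> sat ?L j g \<and> (\<forall>k. i \<le> k \<and> k < j \<longrightarrow> sat ?L k f))"
        using f g Until.prems(5) by (intro ex_cong1) auto
      have all: "(\<forall>k. i \<le> k \<and> k \<le> N \<longrightarrow> sat ?G k f) \<longleftrightarrow> (\<forall>k. i \<le> k \<and> k \<le> N \<longrightarrow> sat ?L k f)"
        using f Until.prems(5) by auto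
      \<comment> \<open>At \<open>Suc N\<close> the glued until equals that of \<open>M\<close> by
        \<open>tail\<close>, and \<open>at\<close> replaces \<open>M\<close> by
        \<open>L\<close>.\<close>
      have rest: "(\<exists>j\<ge>Suc N. sat ?G j g \<and> (\<forall>k. Suc N \<le> k \<and> k < j \<longrightarrow> sat ?G k f)) \<longleftrightarrow>
          (\<exists>j\<ge>Suc N. sat ?L j g \<and> (\<forall>k. Suc N \<le> k \<and> k < j \<longrightarrow> sat ?L k f))"
        using at U[of "Suc N"] K tail[of "Suc N"] by (simp del: sat.simps)
      show ?thesis
        unfolding U[OF \<open>1 \<le> i\<close>] if_P[OF K] if_P[OF True] until_split[OF True] head all rest ..
    qed
  qed
next
  case (Since K f g)
  let ?G = "call_word (glue N L M)" and ?L = "call_word L" and ?M = "call_word M"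
  have f: "sat ?G k f \<longleftrightarrow> (if k \<le> N then sat ?L k f else sat ?M k f)"
    and g: "sat ?G k g \<longleftrightarrow> (if k \<le> N then sat ?L k g else sat ?M k g)" if "1 \<le> k" for k
    using Since.IH(1)[of k] Since.IH(2)[of k] Since.prems that by auto
  have at: "sat ?L N (Since K f g) \<longleftrightarrow> sat ?M N (Since K f g)"
    by (rule Since.prems(3)) simp
  show ?case
  proof (cases "K = Linear \<or> K = Summary")
    case False
    then show ?thesis using g[of i] Since.prems(5) by (simp add: sat_Since_call_word del: sat.simps)
  next
    case K: True
    note S = sat_Since_call_word[of _ _ K f g]
    have head: "(\<exists>j\<le>a. 1 \<le> j \<and> sat ?G j g \<and> (\<forall>k. j < k \<and> k \<le> a \<longrightarrow> sat ?G k f)) \<longleftrightarrow>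
        (\<exists>j\<le>a. 1 \<le> j \<and> sat ?L j g \<and> (\<forall>k. j < k \<and> k \<le> a \<longrightarrow> sat ?L k f))" if "a \<le> N" for a
      using f g that by (intro ex_cong1) auto
    show ?thesis
    proof (cases "i \<le> N")
      case True
      then show ?thesis using S[OF \<open>1 \<le> i\<close>] K head[of i] by (simp del: sat.simps)
    next
      case False
      then have less: "N < i" by simp
      have tail: "(\<exists>j\<le>i. N < j \<and> sat ?G j g \<and> (\<forall>k. j < k \<and> k \<le> i \<longrightarrow> sat ?G k f)) \<longleftrightarrow>
          (\<exists>j\<le>i. N < j \<and> sat ?M j g \<and> (\<forall>k. j < k \<and> k \<le> i \<longrightarrow> sat ?M k f))"
        using f g by (intro ex_cong1) auto
      have all: "(\<forall>k. N < k \<and> k \<le> i \<longrightarrow> sat ?G k f) \<longleftrightarrow> (\<forall>k. N < k \<and> k \<le> i \<longrightarrow> sat ?M k f)"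
        using f by auto
      \<comment> \<open>Dually, \<open>head\<close> moves the since at \<open>N\<close> to
        \<open>L\<close>, and \<open>at\<close> moves it on to \<open>M\<close>.\<close>
      have rest: "(\<exists>j\<le>N. 1 \<le> j \<and> sat ?G j g \<and> (\<forall>k. j < k \<and> k \<le> N \<longrightarrow> sat ?G k f)) \<longleftrightarrow>
          (\<exists>j\<le>N. 1 \<le> j \<and> sat ?M j g \<and> (\<forall>k. j < k \<and> k \<le> N \<longrightarrow> sat ?M k f))"
        using at S[of N] Since.prems(2) K head[of N] by (simp del: sat.simps)
      show ?thesis
        unfolding S[OF \<open>1 \<le> i\<close>] if_P[OF K] if_not_P[OF False]
          since_split[OF \<open>1 \<le> N\<close> less] tail all rest ..
    qed
  qed
\<comment> \<open>Atoms follow \<open>glue\<close>; \<open>NextMu\<close> and \<open>PrevMu\<close>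
  fail as nothing is matched; \<open>nwtl_plus\<close> rules out \<open>Within\<close>.\<close>
qed (auto simp: glue_def)

section \<open>The lower bound\<close>

text \<open>A fooling-set count: the set \<open>S\<close> of letters that carry \<open>0\<close> is
  determined by which subformulas of \<open>g\<close> hold at \<open>N\<close> and at
  \<open>Suc N\<close>. So \<open>2 ^ 2 ^ n\<close> choices inject into pairs of subsets of
  \<open>subfms g\<close>; the pairing explains the factor 2.\<close>

lemma fsize_equivalent_ge:
  assumes g: "g \<in> nwtl_plus_equivalents {0..n} (succinct_fm n)"
  shows "2 ^ n \<le> 2 * fsize g"
proof -
  \<comment> \<open>\<open>N\<close> is both the period of the models and the cut, so each letter
    occurs once before the cut and again after it.\<close>
  define N :: nat where "N = 2 ^ n"
  have N: "1 \<le> N" by (simp add: N_def)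
  have "card (Pow {1..n}) = N" by (simp add: N_def card_Pow)
  then obtain e where e: "bij_betw e {0..<N} (Pow {1..n})"
    using ex_bij_betw_nat_finite[of "Pow {1..n}"] by auto
  \<comment> \<open>Positions start at 1, hence the phase \<open>i - 1\<close>; \<open>S\<close>
    collects the letters at which \<open>0\<close> is set.\<close>
  define L where "L S i = e ((i - 1) mod N) \<union> (if e ((i - 1) mod N) \<in> S then {0} else {})"
    for S i
  have e_sub: "e (k mod N) \<subseteq> {1..n}" for k
    using bij_betwE[OF e] N by auto
  have L_int: "L S i \<inter> {1..n} = e ((i - 1) mod N)" for S i
    using e_sub[of "i - 1"] by (auto simp: L_def)
  have L_0: "0 \<in> L S i \<longleftrightarrow> e ((i - 1) mod N) \<in> S" for S i
    using e_sub[of "i - 1"] by (auto simp: L_def)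
  have L_sub: "L S i \<subseteq> {0..n}" for S i
    using e_sub[of "i - 1"] by (auto simp: L_def)
  have sat_g: "sat (call_word K) 1 g \<longleftrightarrow> functional_labels n K" if "\<And>i. K i \<subseteq> {0..n}" for K
  proof -
    have "nested_omega_word {0..n} (call_word K)"
      using that by (intro nested_omega_word_call_word)
    then show ?thesis
      using g sat_succinct_fm[of "{0..n}" "call_word K" n]
      by (simp add: nwtl_plus_equivalents_def equivalent_def)
  qed
  have model: "sat (call_word (L S)) 1 g" for S
    unfolding sat_g[OF L_sub] functional_labels_def L_int L_0 by simp
  define T where "T S k = {h \<in> subfms g. sat (call_word (L S)) k h}" for S k
  have "inj_on (\<lambda>S. (T S N, T S (Suc N))) (Pow (Pow {1..n}))"
  proof (rule inj_onI)
    fix S S' assume S: "S \<in> Pow (Pow {1..n})" "S' \<in> Pow (Pow {1..n})"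
      and T: "(T S N, T S (Suc N)) = (T S' N, T S' (Suc N))"
    let ?G = "glue N (L S) (L S')"
    have "sat (call_word ?G) 1 g \<longleftrightarrow>
        (if 1 \<le> N then sat (call_word (L S)) 1 g else sat (call_word (L S')) 1 g)"
      using g N T by (intro sat_glue) (auto simp: nwtl_plus_equivalents_def T_def)
    then have "sat (call_word ?G) 1 g" using model by simp
    moreover have "?G i \<subseteq> {0..n}" for i using L_sub by (simp add: glue_def)
    ultimately have func: "functional_labels n ?G" using sat_g by blast
    \<comment> \<open>The letter \<open>x\<close> occurs at \<open>Suc t\<close>, labelled according
      to \<open>S\<close>, and one period later, labelled according to \<open>S'\<close>;
      functionality of the glued word equates the two.\<close>
    have same: "x \<in> S \<longleftrightarrow> x \<in> S'" if "x \<in> Pow {1..n}" for x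
    proof -
      have "x \<in> e ` {0..<N}"
        using that unfolding bij_betw_imp_surj_on[OF e] .
      then obtain t where t: "t < N" "x = e t" by auto
      have G: "?G (Suc t) = L S (Suc t)" "?G (Suc t + N) = L S' (Suc t + N)"
        using t by (auto simp: glue_def)
      have "?G (Suc t) \<inter> {1..n} = ?G (Suc t + N) \<inter> {1..n}"
        unfolding G L_int using t by simp
      then have "0 \<in> ?G (Suc t) \<longleftrightarrow> 0 \<in> ?G (Suc t + N)"
        using func[unfolded functional_labels_def, rule_format, of "Suc t" "Suc t + N"] by simp
      then show ?thesis
        unfolding G L_0 using t by simp
    qed
    have sub: "S \<subseteq> Pow {1..n}" "S' \<subseteq> Pow {1..n}" using S by simp_all
    show "S = S'"
    proof (rule set_eqI)
      fix x
      show "x \<in> S \<longleftrightarrow> x \<in> S'"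
      proof (cases "x \<in> Pow {1..n}")
        case False
        then have "x \<notin> S" "x \<notin> S'" using sub by (meson subsetD)+
        then show ?thesis by simp
      qed (rule same)
    qed
  qed
  moreover have "(\<lambda>S. (T S N, T S (Suc N))) ` Pow (Pow {1..n}) \<subseteq> Pow (subfms g) \<times> Pow (subfms g)"
    by (auto simp: T_def)
  ultimately have "card (Pow (Pow {1..n})) \<le> card (Pow (subfms g) \<times> Pow (subfms g))"
    by (rule card_inj_on_le) (simp add: finite_subfms)
  then have "(2::nat) ^ 2 ^ n \<le> 2 ^ (card (subfms g) + card (subfms g))"
    by (simp add: card_Pow finite_subfms card_cartesian_product power_add)
  then have "2 ^ n \<le> card (subfms g) + card (subfms g)"
    by (simp only: power_increasing_iff one_less_numeral_iff semiring_norm)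
  with card_subfms_le[of g] show ?thesis by linarith
qed

theorem theorem5p6:
  "\<exists>(AP :: nat \<Rightarrow> nat set) (\<phi> :: nat \<Rightarrow> nat fm).
     (\<forall>n\<ge>1. finite (AP n) \<and> props (\<phi> n) \<subseteq> AP n) \<and>
     (\<lambda>n. real (fsize (\<phi> n))) \<in> O(\<lambda>n. real n) \<and>
     (\<forall>n\<ge>1. nwtl_plus_equivalents (AP n) (\<phi> n) \<noteq> {}) \<and>
     (\<exists>c>0. \<forall>\<^sub>F n in sequentially.
        2 powr (c * real n) \<le> real (min_nwtl_plus_size (AP n) (\<phi> n)))"
proof (intro exI[of _ "\<lambda>n. {0..n}"] exI[of _ succinct_fm] conjI allI impI)
  fix n :: nat
  show "props (succinct_fm n) \<subseteq> {0..n}"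
    by (auto simp: succinct_fm_def as_initially_def simp del: upt_Suc)
  show "nwtl_plus_equivalents {0..n} (succinct_fm n) \<noteq> {}"
    using plain_fm_in_equivalents by blast
next
  show "(\<lambda>n. real (fsize (succinct_fm n))) \<in> O(\<lambda>n. real n)"
  \<comment> \<open>\<open>86 = 52 + 34\<close>, which suffices once
    \<open>n \<ge> 1\<close>.\<close>
  proof (rule bigoI[of _ 86])
    show "\<forall>\<^sub>F n in sequentially. norm (real (fsize (succinct_fm n))) \<le> 86 * norm (real n)"
      using eventually_ge_at_top[of 1] by eventually_elim (simp add: fsize_succinct_fm)
  qed
next
  \<comment> \<open>From \<open>n = 2\<close> on, \<open>n / 2 \<le> n - 1\<close>, so halving the
    exponent absorbs the factor 2 lost in the count.\<close>
  have "2 powr (1 / 2 * real n) \<le> real (min_nwtl_plus_size {0..n} (succinct_fm n))"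
    if n: "2 \<le> n" for n
  proof -
    \<comment> \<open>The \<open>LEAST\<close> is attained because \<open>plain_fm n\<close> is an
      equivalent.\<close>
    obtain g where g: "g \<in> nwtl_plus_equivalents {0..n} (succinct_fm n)"
      and eq: "min_nwtl_plus_size {0..n} (succinct_fm n) = fsize g"
      using LeastI_ex[of "\<lambda>s. \<exists>g\<in>nwtl_plus_equivalents {0..n} (succinct_fm n). s = fsize g"]
        plain_fm_in_equivalents unfolding min_nwtl_plus_size_def by blast
    have "2 powr (1 / 2 * real n) \<le> 2 powr (real n - 1)"
      using n by (intro powr_mono) auto
    also have "\<dots> = 2 ^ n / 2"
      by (simp add: powr_diff powr_realpow)
    also have "\<dots> \<le> real (fsize g)"
    proof -
      have "real (2 ^ n) \<le> real (2 * fsize g)"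
        using fsize_equivalent_ge[OF g] by (simp only: of_nat_le_iff)
      then show ?thesis by simp
    qed
    finally show ?thesis by (simp add: eq)
  qed
  then show "\<exists>c>0. \<forall>\<^sub>F n in sequentially.
      2 powr (c * real n) \<le> real (min_nwtl_plus_size {0..n} (succinct_fm n))"
    by (intro exI[of _ "1 / 2"]) (auto simp: eventually_sequentially)
qed simp

end
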